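(* Let $\mathsf{A}$ be an abelian category and $\mathsf{V}$ a special preenveloping subcategory of $\mathsf{A}$. Suppose that $\mathsf{V}$ is closed under direct summands. Then the following statements are equivalent for an object $N$ in $\mathsf{A}$: (i) The functor $\overline{\operatorname{Hom}}{}^{\mathsf{V}}_{\mathsf{A}}(-,N)$ is right $\operatorname{Hom}_{\mathsf{A}}(-,\mathsf{V})$-exact. (ii) $\overline{\operatorname{Hom}}{}^{\mathsf{V}}_{\mathsf{A}}(M,N)=0$ for each object $M$ in $\mathsf{A}$. (iii) $N\in\mathsf{V}$.
   Context: "Subcategory" means a full additive subcategory closed under isomorphisms; Ext is Yoneda Ext. ${}^{\perp}\mathsf{V}=\{M\mid\operatorname{Ext}^1_{\mathsf{A}}(M,V)=0\ \forall V\in\mathsf{V}\}$. $\mathsf{V}$ is special preenveloping if every object $M$ admits an exact sequence $0\to M\to V\to C\to0$ with $V\in\mathsf{V}$, $C\in{}^{\perp}\mathsf{V}$. $\overline{\operatorname{Hom}}{}^{\mathsf{V}}_{\mathsf{A}}(M,N)$ is the quotient of $\operatorname{Hom}_{\mathsf{A}}(M,N)$ by the subgroup of morphisms factoring through an object of $\mathsf{V}$. A short exact sequence is $\operatorname{Hom}_{\mathsf{A}}(-,\mathsf{V})$-exact if it stays exact under $\operatorname{Hom}_{\mathsf{A}}(-,V)$ for every $V\in\mathsf{V}$. A contravariant additive functor $\mathrm{F}\colon\mathsf{A}\to\mathsf{Ab}$ is right $\operatorname{Hom}_{\mathsf{A}}(-,\mathsf{V})$-exact if for each $\operatorname{Hom}_{\mathsf{A}}(-,\mathsf{V})$-exact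 short exact sequence $0\to A'\to A\to A''\to0$ the sequence $\mathrm{F}(A'')\to\mathrm{F}(A)\to\mathrm{F}(A')\to0$ is exact. *)

theory Defs
  imports "HOL-Algebra.Exact_Sequence"
begin

section \<open>Abelian categories\<close>

text \<open>
  A category is given by a set of objects and a set of arrows with domain and codomain,
  identities and a composition (\<open>g \<cdot> f\<close> is ``g after f''). \<open>Add\<close> and \<open>Zero\<close> are the addition of
  parallel arrows and the zero arrows. All operations are only constrained on the carriers.
\<close>

record ('o, 'm) precat =
  Obj :: "'o set"
  Arr :: "'m set"
  Dom :: "'m \<Rightarrow> 'o"
  Cod :: "'m \<Rightarrow> 'o"
  Ident :: "'o \<Rightarrow> 'm"
  Comp :: "'m \<Rightarrow> 'm \<Rightarrow> 'm"  (infixr "\<cdot>\<index>" 75)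
  Add :: "'m \<Rightarrow> 'm \<Rightarrow> 'm"
  Zero :: "'o \<Rightarrow> 'o \<Rightarrow> 'm"

definition Homs :: "('o, 'm) precat \<Rightarrow> 'o \<Rightarrow> 'o \<Rightarrow> 'm set" where
  "Homs C X Y = {f \<in> Arr C. Dom C f = X \<and> Cod C f = Y}"

text \<open>The additive group \<open>Hom(X, Y)\<close>; as in HOL-Algebra's \<open>comm_group\<close> it is written as a
  multiplicative record, so that subgroups, cosets and quotients of the library apply.\<close>

definition Hom_group :: "('o, 'm) precat \<Rightarrow> 'o \<Rightarrow> 'o \<Rightarrow> 'm monoid" where
  "Hom_group C X Y = \<lparr>carrier = Homs C X Y, mult = Add C, one = Zero C X Y\<rparr>"

locale category =
  fixes C :: "('o, 'm) precat" (structure)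
  assumes Dom_closed: "f \<in> Arr C \<Longrightarrow> Dom C f \<in> Obj C"
    and Cod_closed: "f \<in> Arr C \<Longrightarrow> Cod C f \<in> Obj C"
    and Ident_closed: "X \<in> Obj C \<Longrightarrow> Ident C X \<in> Homs C X X"
    and Comp_closed: "\<lbrakk>f \<in> Homs C X Y; g \<in> Homs C Y Z\<rbrakk> \<Longrightarrow> g \<cdot> f \<in> Homs C X Z"
    and Comp_assoc: "\<lbrakk>f \<in> Homs C W X; g \<in> Homs C X Y; h \<in> Homs C Y Z\<rbrakk>
        \<Longrightarrow> (h \<cdot> g) \<cdot> f = h \<cdot> (g \<cdot> f)"
    and Comp_Ident_right: "f \<in> Homs C X Y \<Longrightarrow> f \<cdot> Ident C X = f"
    and Comp_Ident_left: "f \<in> Homs C X Y \<Longrightarrow> Ident C Y \<cdot> f = f"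

locale preadditive_category = category C for C :: "('o, 'm) precat" (structure) +
  assumes Hom_comm_group: "\<lbrakk>X \<in> Obj C; Y \<in> Obj C\<rbrakk> \<Longrightarrow> comm_group (Hom_group C X Y)"
    and Comp_Add_right: "\<lbrakk>f \<in> Homs C X Y; f' \<in> Homs C X Y; g \<in> Homs C Y Z\<rbrakk>
        \<Longrightarrow> g \<cdot> Add C f f' = Add C (g \<cdot> f) (g \<cdot> f')"
    and Comp_Add_left: "\<lbrakk>f \<in> Homs C X Y; g \<in> Homs C Y Z; g' \<in> Homs C Y Z\<rbrakk>
        \<Longrightarrow> Add C g g' \<cdot> f = Add C (g \<cdot> f) (g' \<cdot> f)"

definition is_zero_object :: "('o, 'm) precat \<Rightarrow> 'o \<Rightarrow> bool" where
  "is_zero_object C Z \<longleftrightarrow> Z \<in> Obj C \<and>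
     (\<forall>X\<in>Obj C. (\<exists>!f. f \<in> Homs C X Z) \<and> (\<exists>!f. f \<in> Homs C Z X))"

text \<open>\<open>B\<close> is the biproduct of \<open>X\<close> and \<open>Y\<close> with injections \<open>i, j\<close> and projections \<open>p, q\<close>.\<close>

definition is_biproduct ::
  "('o, 'm) precat \<Rightarrow> 'o \<Rightarrow> 'o \<Rightarrow> 'o \<Rightarrow> 'm \<Rightarrow> 'm \<Rightarrow> 'm \<Rightarrow> 'm \<Rightarrow> bool" where
  "is_biproduct C X Y B i j p q \<longleftrightarrow>
     X \<in> Obj C \<and> Y \<in> Obj C \<and> B \<in> Obj C \<and>
     i \<in> Homs C X B \<and> j \<in> Homs C Y B \<and> p \<in> Homs C B X \<and> q \<in> Homs C B Y \<and>
     p \<cdot>\<^bsub>C\<^esub> i = Ident C X \<and> q \<cdot>\<^bsub>C\<^esub> j = Ident C Y \<and>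
     p \<cdot>\<^bsub>C\<^esub> j = Zero C Y X \<and> q \<cdot>\<^bsub>C\<^esub> i = Zero C X Y \<and>
     Add C (i \<cdot>\<^bsub>C\<^esub> p) (j \<cdot>\<^bsub>C\<^esub> q) = Ident C B"

definition is_monic :: "('o, 'm) precat \<Rightarrow> 'm \<Rightarrow> bool" where
  "is_monic C f \<longleftrightarrow> f \<in> Arr C \<and>
     (\<forall>W\<in>Obj C. \<forall>g\<in>Homs C W (Dom C f). \<forall>h\<in>Homs C W (Dom C f). f \<cdot>\<^bsub>C\<^esub> g = f \<cdot>\<^bsub>C\<^esub> h \<longrightarrow> g = h)"

definition is_epic :: "('o, 'm) precat \<Rightarrow> 'm \<Rightarrow> bool" where
  "is_epic C f \<longleftrightarrow> f \<in> Arr C \<and>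
     (\<forall>W\<in>Obj C. \<forall>g\<in>Homs C (Cod C f) W. \<forall>h\<in>Homs C (Cod C f) W. g \<cdot>\<^bsub>C\<^esub> f = h \<cdot>\<^bsub>C\<^esub> f \<longrightarrow> g = h)"

definition is_isomorphism :: "('o, 'm) precat \<Rightarrow> 'm \<Rightarrow> bool" where
  "is_isomorphism C f \<longleftrightarrow> f \<in> Arr C \<and>
     (\<exists>g\<in>Homs C (Cod C f) (Dom C f). g \<cdot>\<^bsub>C\<^esub> f = Ident C (Dom C f) \<and> f \<cdot>\<^bsub>C\<^esub> g = Ident C (Cod C f))"

definition isomorphic_objects :: "('o, 'm) precat \<Rightarrow> 'o \<Rightarrow> 'o \<Rightarrow> bool" where
  "isomorphic_objects C X Y \<longleftrightarrow> (\<exists>f\<in>Homs C X Y. is_isomorphism C f)"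

definition is_kernel :: "('o, 'm) precat \<Rightarrow> 'm \<Rightarrow> 'm \<Rightarrow> bool" where
  "is_kernel C f k \<longleftrightarrow> f \<in> Arr C \<and> k \<in> Arr C \<and> Cod C k = Dom C f \<and>
     f \<cdot>\<^bsub>C\<^esub> k = Zero C (Dom C k) (Cod C f) \<and>
     (\<forall>W\<in>Obj C. \<forall>h\<in>Homs C W (Dom C f). f \<cdot>\<^bsub>C\<^esub> h = Zero C W (Cod C f) \<longrightarrow>
        (\<exists>!u. u \<in> Homs C W (Dom C k) \<and> k \<cdot>\<^bsub>C\<^esub> u = h))"

definition is_cokernel :: "('o, 'm) precat \<Rightarrow> 'm \<Rightarrow> 'm \<Rightarrow> bool" where
  "is_cokernel C f c \<longleftrightarrow> f \<in> Arr C \<and> c \<in> Arr C \<and> Dom C c = Cod C f \<and>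
     c \<cdot>\<^bsub>C\<^esub> f = Zero C (Dom C f) (Cod C c) \<and>
     (\<forall>W\<in>Obj C. \<forall>h\<in>Homs C (Cod C f) W. h \<cdot>\<^bsub>C\<^esub> f = Zero C (Dom C f) W \<longrightarrow>
        (\<exists>!u. u \<in> Homs C (Cod C c) W \<and> u \<cdot>\<^bsub>C\<^esub> c = h))"

locale abelian_category = preadditive_category C for C :: "('o, 'm) precat" (structure) +
  assumes ex_zero_object: "\<exists>Z. is_zero_object C Z"
    and ex_biproduct: "\<lbrakk>X \<in> Obj C; Y \<in> Obj C\<rbrakk> \<Longrightarrow> \<exists>B i j p q. is_biproduct C X Y B i j p q"
    and ex_kernel: "f \<in> Arr C \<Longrightarrow> \<exists>k. is_kernel C f k"
    and ex_cokernel: "f \<in> Arr C \<Longrightarrow> \<exists>c. is_cokernel C f c"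
    and monic_is_kernel: "is_monic C f \<Longrightarrow> \<exists>g. is_kernel C g f"
    and epic_is_cokernel: "is_epic C f \<Longrightarrow> \<exists>g. is_cokernel C g f"


section \<open>Short exact sequences and Yoneda Ext\<close>

text \<open>The image of \<open>f\<close> is the kernel of its cokernel.\<close>

definition is_image :: "('o, 'm) precat \<Rightarrow> 'm \<Rightarrow> 'm \<Rightarrow> bool" where
  "is_image C f m \<longleftrightarrow> (\<exists>c. is_cokernel C f c \<and> is_kernel C c m)"

definition exact_at :: "('o, 'm) precat \<Rightarrow> 'm \<Rightarrow> 'm \<Rightarrow> bool" where
  "exact_at C f g \<longleftrightarrow> (\<exists>m. is_image C f m \<and> is_kernel C g m)"

text \<open>\<open>0 \<rightarrow> Dom f \<rightarrow> Cod f = Dom g \<rightarrow> Cod g \<rightarrow> 0\<close> is exact.\<close>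

definition short_exact :: "('o, 'm) precat \<Rightarrow> 'm \<Rightarrow> 'm \<Rightarrow> bool" where
  "short_exact C f g \<longleftrightarrow> Cod C f = Dom C g \<and> is_monic C f \<and> exact_at C f g \<and> is_epic C g"

text \<open>Extensions \<open>0 \<rightarrow> N \<rightarrow> E \<rightarrow> M \<rightarrow> 0\<close> of \<open>M\<close> by \<open>N\<close>, given by their two arrows.\<close>

definition extensions :: "('o, 'm) precat \<Rightarrow> 'o \<Rightarrow> 'o \<Rightarrow> ('m \<times> 'm) set" where
  "extensions C M N = {(f, g). short_exact C f g \<and> Dom C f = N \<and> Cod C g = M}"

text \<open>By the five lemma, a morphism of extensions which is the identity on both ends is an
  isomorphism, so Yoneda's relation can be stated with isomorphisms.\<close>

definition extension_equiv :: "('o, 'm) precat \<Rightarrow> 'o \<Rightarrow> 'o \<Rightarrow> (('m \<times> 'm) \<times> ('m \<times> 'm)) set" where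
  "extension_equiv C M N = {((f, g), (f', g')).
     (f, g) \<in> extensions C M N \<and> (f', g') \<in> extensions C M N \<and>
     (\<exists>\<phi>\<in>Homs C (Cod C f) (Cod C f'). is_isomorphism C \<phi> \<and> \<phi> \<cdot>\<^bsub>C\<^esub> f = f' \<and> g' \<cdot>\<^bsub>C\<^esub> \<phi> = g)}"

definition Ext1 :: "('o, 'm) precat \<Rightarrow> 'o \<Rightarrow> 'o \<Rightarrow> ('m \<times> 'm) set set" where
  "Ext1 C M N = extensions C M N // extension_equiv C M N"

text \<open>The neutral element of \<open>Ext1 C M N\<close> for the Baer sum is the class of
  \<open>0 \<rightarrow> N \<rightarrow> N \<oplus> M \<rightarrow> M \<rightarrow> 0\<close>; it consists of all such sequences, for all choices of the biproduct.\<close>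

definition Ext1_zero :: "('o, 'm) precat \<Rightarrow> 'o \<Rightarrow> 'o \<Rightarrow> ('m \<times> 'm) set" where
  "Ext1_zero C M N = {(i, q). \<exists>B j p. is_biproduct C N M B i j p q}"

definition Ext1_vanishes :: "('o, 'm) precat \<Rightarrow> 'o \<Rightarrow> 'o \<Rightarrow> bool" where
  "Ext1_vanishes C M N \<longleftrightarrow> Ext1 C M N = {Ext1_zero C M N}"


section \<open>Special preenveloping subcategories\<close>

text \<open>A full subcategory is identified with its set of objects; being full, it is additive iff it
  has a zero object and binary biproducts.\<close>

definition additive_subcategory :: "('o, 'm) precat \<Rightarrow> 'o set \<Rightarrow> bool" where
  "additive_subcategory C V \<longleftrightarrow> V \<subseteq> Obj C \<and>
     (\<exists>Z\<in>V. is_zero_object C Z) \<and>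
     (\<forall>X\<in>V. \<forall>Y\<in>V. \<exists>B\<in>V. \<exists>i j p q. is_biproduct C X Y B i j p q) \<and>
     (\<forall>X\<in>V. \<forall>Y\<in>Obj C. isomorphic_objects C X Y \<longrightarrow> Y \<in> V)"

definition left_Ext_perp :: "('o, 'm) precat \<Rightarrow> 'o set \<Rightarrow> 'o set" where
  "left_Ext_perp C V = {M \<in> Obj C. \<forall>X\<in>V. Ext1_vanishes C M X}"

definition special_preenveloping :: "('o, 'm) precat \<Rightarrow> 'o set \<Rightarrow> bool" where
  "special_preenveloping C V \<longleftrightarrow>
     (\<forall>M\<in>Obj C. \<exists>f g. short_exact C f g \<and> Dom C f = M \<and> Cod C f \<in> V \<and> Cod C g \<in> left_Ext_perp C V)"

definition closed_under_direct_summands :: "('o, 'm) precat \<Rightarrow> 'o set \<Rightarrow> bool" where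
  "closed_under_direct_summands C V \<longleftrightarrow>
     (\<forall>B\<in>V. \<forall>X Y i j p q. is_biproduct C X Y B i j p q \<longrightarrow> X \<in> V)"


section \<open>Contravariant additive functors to abelian groups\<close>

record ('o, 'm, 'a) cofunctor =
  FObj :: "'o \<Rightarrow> 'a monoid"
  FMap :: "'m \<Rightarrow> 'a \<Rightarrow> 'a"

definition additive_cofunctor :: "('o, 'm) precat \<Rightarrow> ('o, 'm, 'a) cofunctor \<Rightarrow> bool" where
  "additive_cofunctor C F \<longleftrightarrow>
     (\<forall>X\<in>Obj C. comm_group (FObj F X)) \<and>
     (\<forall>f\<in>Arr C. FMap F f \<in> hom (FObj F (Cod C f)) (FObj F (Dom C f))) \<and>
     (\<forall>X\<in>Obj C. \<forall>x\<in>carrier (FObj F X). FMap F (Ident C X) x = x) \<and>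
     (\<forall>f\<in>Arr C. \<forall>g\<in>Arr C. Cod C f = Dom C g \<longrightarrow>
        (\<forall>x\<in>carrier (FObj F (Cod C g)). FMap F (g \<cdot>\<^bsub>C\<^esub> f) x = FMap F f (FMap F g x))) \<and>
     (\<forall>X\<in>Obj C. \<forall>Y\<in>Obj C. \<forall>f\<in>Homs C X Y. \<forall>f'\<in>Homs C X Y. \<forall>x\<in>carrier (FObj F Y).
        FMap F (Add C f f') x = FMap F f x \<otimes>\<^bsub>FObj F X\<^esub> FMap F f' x)"

definition Hom_functor :: "('o, 'm) precat \<Rightarrow> 'o \<Rightarrow> ('o, 'm, 'm) cofunctor" where
  "Hom_functor C N = \<lparr>FObj = (\<lambda>M. Hom_group C M N), FMap = (\<lambda>f h. h \<cdot>\<^bsub>C\<^esub> f)\<rparr>"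

definition factoring :: "('o, 'm) precat \<Rightarrow> 'o set \<Rightarrow> 'o \<Rightarrow> 'o \<Rightarrow> 'm set" where
  "factoring C V M N = {h \<cdot>\<^bsub>C\<^esub> g | g h X. X \<in> V \<and> g \<in> Homs C M X \<and> h \<in> Homs C X N}"

definition stable_Hom :: "('o, 'm) precat \<Rightarrow> 'o set \<Rightarrow> 'o \<Rightarrow> 'o \<Rightarrow> 'm set monoid" where
  "stable_Hom C V M N = Hom_group C M N Mod factoring C V M N"

text \<open>An arrow \<open>f\<close> sends the coset of \<open>h\<close> to the coset of \<open>h \<cdot> f\<close>; the union over the
  representatives \<open>h\<close> of \<open>K\<close> is a union of equal cosets.\<close>

definition stable_Hom_functor :: "('o, 'm) precat \<Rightarrow> 'o set \<Rightarrow> 'o \<Rightarrow> ('o, 'm, 'm set) cofunctor" where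
  "stable_Hom_functor C V N =
     \<lparr>FObj = (\<lambda>M. stable_Hom C V M N),
      FMap = (\<lambda>f K. \<Union>h\<in>K. factoring C V (Dom C f) N #>\<^bsub>Hom_group C (Dom C f) N\<^esub> (h \<cdot>\<^bsub>C\<^esub> f))\<rparr>"

definition Hom_exact :: "('o, 'm) precat \<Rightarrow> 'o set \<Rightarrow> 'm \<Rightarrow> 'm \<Rightarrow> bool" where
  "Hom_exact C V f g \<longleftrightarrow> short_exact C f g \<and>
     (\<forall>X\<in>V. let F = Hom_functor C X in
        inj_on (FMap F g) (carrier (FObj F (Cod C g))) \<and>
        exact_seq ([FObj F (Dom C f), FObj F (Cod C f), FObj F (Cod C g)], [FMap F f, FMap F g]) \<and>
        FMap F f ` carrier (FObj F (Cod C f)) = carrier (FObj F (Dom C f)))"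

definition right_Hom_exact :: "('o, 'm) precat \<Rightarrow> 'o set \<Rightarrow> ('o, 'm, 'a) cofunctor \<Rightarrow> bool" where
  "right_Hom_exact C V F \<longleftrightarrow> additive_cofunctor C F \<and>
     (\<forall>f g. Hom_exact C V f g \<longrightarrow>
        exact_seq ([FObj F (Dom C f), FObj F (Cod C f), FObj F (Cod C g)], [FMap F f, FMap F g]) \<and>
        FMap F f ` carrier (FObj F (Cod C f)) = carrier (FObj F (Dom C f)))"

end

theory Submission
  imports Defs
begin

text \<open>
  For the step from (i) to (iii), let \<open>0 \<rightarrow> N \<rightarrow> V \<rightarrow> C \<rightarrow> 0\<close> be a special preenvelope. For \<open>X\<close> in the
  subcategory, the pushout of this sequence along an arrow \<open>N \<rightarrow> X\<close> is an extension of \<open>C\<close> by \<open>X\<close>,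
  hence splits, and a retraction of \<open>X \<rightarrow> P\<close> extends the arrow to \<open>V\<close>. The sequence is therefore
  \<open>Hom(-, V)\<close>-exact, and the stable Hom group from \<open>N\<close> to \<open>N\<close> is a quotient of the one from \<open>V\<close>
  to \<open>N\<close>, which vanishes. So the identity of \<open>N\<close> factors through the subcategory, which makes \<open>N\<close>
  a direct summand of an object of it.
\<close>

section \<open>Typed forms of the universal properties\<close>

lemma HomsI: "f \<in> Arr C \<Longrightarrow> f \<in> Homs C (Dom C f) (Cod C f)"
  by (simp add: Homs_def)

lemma HomsD: "f \<in> Homs C X Y \<Longrightarrow> f \<in> Arr C \<and> Dom C f = X \<and> Cod C f = Y"
  by (simp add: Homs_def)

text \<open>This and the next three restatements replace \<open>Dom\<close> and \<open>Cod\<close>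
  by named objects, so that the universal properties apply directly to arrows given by membership in
  \<open>Homs\<close>.\<close>

lemma is_kernel_iff:
  assumes "f \<in> Homs C X Y" "k \<in> Homs C K X"
  shows "is_kernel C f k \<longleftrightarrow> f \<cdot>\<^bsub>C\<^esub> k = Zero C K Y \<and>
     (\<forall>W\<in>Obj C. \<forall>h\<in>Homs C W X. f \<cdot>\<^bsub>C\<^esub> h = Zero C W Y \<longrightarrow> (\<exists>!u. u \<in> Homs C W K \<and> k \<cdot>\<^bsub>C\<^esub> u = h))"
  using HomsD[OF assms(1)] HomsD[OF assms(2)] by (auto simp: is_kernel_def)

lemma is_cokernel_iff:
  assumes "f \<in> Homs C X Y" "c \<in> Homs C Y Q"
  shows "is_cokernel C f c \<longleftrightarrow> c \<cdot>\<^bsub>C\<^esub> f = Zero C X Q \<and>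
     (\<forall>W\<in>Obj C. \<forall>h\<in>Homs C Y W. h \<cdot>\<^bsub>C\<^esub> f = Zero C X W \<longrightarrow> (\<exists>!u. u \<in> Homs C Q W \<and> u \<cdot>\<^bsub>C\<^esub> c = h))"
  using HomsD[OF assms(1)] HomsD[OF assms(2)] by (auto simp: is_cokernel_def)

lemma is_monic_iff:
  assumes "f \<in> Homs C X Y"
  shows "is_monic C f \<longleftrightarrow>
     (\<forall>W\<in>Obj C. \<forall>g\<in>Homs C W X. \<forall>h\<in>Homs C W X. f \<cdot>\<^bsub>C\<^esub> g = f \<cdot>\<^bsub>C\<^esub> h \<longrightarrow> g = h)"
  using HomsD[OF assms] by (auto simp: is_monic_def)

lemma is_epic_iff:
  assumes "f \<in> Homs C X Y"
  shows "is_epic C f \<longleftrightarrow>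
     (\<forall>W\<in>Obj C. \<forall>g\<in>Homs C Y W. \<forall>h\<in>Homs C Y W. g \<cdot>\<^bsub>C\<^esub> f = h \<cdot>\<^bsub>C\<^esub> f \<longrightarrow> g = h)"
  using HomsD[OF assms] by (auto simp: is_epic_def)

context category
begin

lemma Homs_Obj: "f \<in> Homs C X Y \<Longrightarrow> X \<in> Obj C \<and> Y \<in> Obj C"
  using Dom_closed Cod_closed by (auto simp: Homs_def)

end

section \<open>Arithmetic of arrows, monics and epics in a preadditive category\<close>

context preadditive_category
begin

lemma Zero_closed: "X \<in> Obj C \<Longrightarrow> Y \<in> Obj C \<Longrightarrow> Zero C X Y \<in> Homs C X Y"
  using group.is_monoid[OF comm_group.axioms(2)[OF Hom_comm_group], THEN monoid.one_closed]
  by (simp add: Hom_group_def)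

lemma Add_closed:
  assumes "f \<in> Homs C X Y" "g \<in> Homs C X Y"
  shows "Add C f g \<in> Homs C X Y"
proof -
  interpret G: comm_group "Hom_group C X Y"
    using Hom_comm_group Homs_Obj[OF assms(1)] by blast
  show ?thesis using G.m_closed assms by (simp add: Hom_group_def)
qed

lemma Add_commute:
  assumes "f \<in> Homs C X Y" "g \<in> Homs C X Y"
  shows "Add C f g = Add C g f"
proof -
  interpret G: comm_group "Hom_group C X Y"
    using Hom_comm_group Homs_Obj[OF assms(1)] by blast
  show ?thesis using G.m_comm assms by (simp add: Hom_group_def)
qed

lemma Add_Zero:
  assumes "f \<in> Homs C X Y"
  shows "Add C f (Zero C X Y) = f" "Add C (Zero C X Y) f = f"
proof -
  interpret G: comm_group "Hom_group C X Y"
    using Hom_comm_group Homs_Obj[OF assms(1)] by blast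
  show "Add C f (Zero C X Y) = f" "Add C (Zero C X Y) f = f"
    using G.r_one G.l_one assms by (simp_all add: Hom_group_def)
qed

lemma ex_negative:
  assumes "f \<in> Homs C X Y"
  shows "\<exists>f'\<in>Homs C X Y. Add C f f' = Zero C X Y \<and> Add C f' f = Zero C X Y"
proof -
  interpret G: comm_group "Hom_group C X Y"
    using Hom_comm_group Homs_Obj[OF assms(1)] by blast
  have "f \<in> carrier (Hom_group C X Y)" using assms by (simp add: Hom_group_def)
  then show ?thesis
    using G.inv_closed G.r_inv G.l_inv
    by (intro bexI[of _ "inv\<^bsub>Hom_group C X Y\<^esub> f"]) (simp_all add: Hom_group_def)
qed

lemma Add_left_cancel:
  assumes "f \<in> Homs C X Y" "g \<in> Homs C X Y" "h \<in> Homs C X Y" "Add C f g = Add C f h"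
  shows "g = h"
proof -
  interpret G: comm_group "Hom_group C X Y"
    using Hom_comm_group Homs_Obj[OF assms(1)] by blast
  show ?thesis using G.Units_l_cancel[of f g h] G.Units_eq assms by (simp add: Hom_group_def)
qed

lemma Comp_Zero_right:
  assumes "g \<in> Homs C Y Z" "X \<in> Obj C"
  shows "g \<cdot> Zero C X Y = Zero C X Z"
proof -
  have Y: "Y \<in> Obj C" and Z: "Z \<in> Obj C" using Homs_Obj[OF assms(1)] by auto
  note z = Zero_closed[OF assms(2) Y]
  note gz = Comp_closed[OF z assms(1)]
  have "Add C (g \<cdot> Zero C X Y) (g \<cdot> Zero C X Y) = Add C (g \<cdot> Zero C X Y) (Zero C X Z)"
    using Comp_Add_right[OF z z assms(1)] Add_Zero(1)[OF z] Add_Zero(1)[OF gz] by simp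
  then show ?thesis using Add_left_cancel[OF gz gz Zero_closed[OF assms(2) Z]] by simp
qed

lemma Comp_Zero_left:
  assumes "f \<in> Homs C X Y" "Z \<in> Obj C"
  shows "Zero C Y Z \<cdot> f = Zero C X Z"
proof -
  have X: "X \<in> Obj C" and Y: "Y \<in> Obj C" using Homs_Obj[OF assms(1)] by auto
  note z = Zero_closed[OF Y assms(2)]
  note gz = Comp_closed[OF assms(1) z]
  have "Add C (Zero C Y Z \<cdot> f) (Zero C Y Z \<cdot> f) = Add C (Zero C Y Z \<cdot> f) (Zero C X Z)"
    using Comp_Add_left[OF assms(1) z z] Add_Zero(1)[OF z] Add_Zero(1)[OF gz] by simp
  then show ?thesis using Add_left_cancel[OF gz gz Zero_closed[OF X assms(2)]] by simp
qed

text \<open>If two arrows have the same composite with \<open>f\<close>, their difference is killed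
  by \<open>f\<close>. Subtraction is spelled out as addition of a negative \<open>h'\<close> of
  \<open>h\<close>.\<close>

lemma is_monicI:
  assumes f: "f \<in> Homs C X Y"
    and zero: "\<And>W h. h \<in> Homs C W X \<Longrightarrow> f \<cdot> h = Zero C W Y \<Longrightarrow> h = Zero C W X"
  shows "is_monic C f"
  unfolding is_monic_iff[OF f]
proof (intro ballI impI)
  fix W g h assume g: "g \<in> Homs C W X" and h: "h \<in> Homs C W X" and eq: "f \<cdot> g = f \<cdot> h"
  obtain h' where h': "h' \<in> Homs C W X" "Add C h h' = Zero C W X" "Add C h' h = Zero C W X"
    using ex_negative[OF h] by blast
  have W: "W \<in> Obj C" using Homs_Obj[OF g] by blast
  have "f \<cdot> Add C g h' = f \<cdot> Add C h h'"
    using Comp_Add_right[OF g h'(1) f] Comp_Add_right[OF h h'(1) f] eq by simp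
  then have "Add C g h' = Zero C W X"
    using zero[OF Add_closed[OF g h'(1)]] h'(2) Comp_Zero_right[OF f W] by simp
  then have "Add C h' g = Add C h' h"
    using Add_commute[OF g h'(1)] h'(3) by simp
  then show "g = h" using Add_left_cancel[OF h'(1) g h] by blast
qed

lemma monic_zero:
  assumes f: "f \<in> Homs C X Y" "is_monic C f" and h: "h \<in> Homs C W X" "f \<cdot> h = Zero C W Y"
  shows "h = Zero C W X"
proof -
  have W: "W \<in> Obj C" "X \<in> Obj C" using Homs_Obj[OF h(1)] by auto
  show ?thesis
    using f(2) h Comp_Zero_right[OF f(1) W(1)] Zero_closed[OF W] W
    unfolding is_monic_iff[OF f(1)] by metis
qed

text \<open>Both \<open>g\<close> and \<open>h\<close> lift the same arrow
  \<open>k \<cdot> g\<close>, which \<open>f\<close> kills; uniqueness of lifts identifies them. The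
  statement for cokernels below is dual.\<close>

lemma kernel_is_monic:
  assumes f: "f \<in> Homs C X Y" and k: "k \<in> Homs C K X" and ker: "is_kernel C f k"
  shows "is_monic C k"
  unfolding is_monic_iff[OF k]
proof (intro ballI impI)
  fix W g h assume W: "W \<in> Obj C" and g: "g \<in> Homs C W K" and h: "h \<in> Homs C W K"
    and eq: "k \<cdot> g = k \<cdot> h"
  have Y: "Y \<in> Obj C" using Homs_Obj[OF f] by blast
  have "f \<cdot> (k \<cdot> g) = Zero C W Y"
    using Comp_assoc[OF g k f] ker Comp_Zero_left[OF g Y] unfolding is_kernel_iff[OF f k] by simp
  then have "\<exists>!u. u \<in> Homs C W K \<and> k \<cdot> u = k \<cdot> g"
    using ker Comp_closed[OF g k] W unfolding is_kernel_iff[OF f k] by blast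
  then show "g = h" using g h eq by metis
qed

lemma cokernel_is_epic:
  assumes f: "f \<in> Homs C X Y" and c: "c \<in> Homs C Y Q" and coker: "is_cokernel C f c"
  shows "is_epic C c"
  unfolding is_epic_iff[OF c]
proof (intro ballI impI)
  fix W g h assume W: "W \<in> Obj C" and g: "g \<in> Homs C Q W" and h: "h \<in> Homs C Q W"
    and eq: "g \<cdot> c = h \<cdot> c"
  have X: "X \<in> Obj C" using Homs_Obj[OF f] by blast
  have "(g \<cdot> c) \<cdot> f = Zero C X W"
    using Comp_assoc[OF f c g] coker Comp_Zero_right[OF g X] unfolding is_cokernel_iff[OF f c]
    by simp
  then have "\<exists>!u. u \<in> Homs C Q W \<and> u \<cdot> c = g \<cdot> c"
    using coker Comp_closed[OF c g] W unfolding is_cokernel_iff[OF f c] by blast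
  then show "g = h" using g h eq by metis
qed

end

section \<open>Short exact sequences in an abelian category\<close>

context abelian_category
begin

text \<open>The axioms provide some \<open>e\<close> with kernel \<open>f\<close>. As
  \<open>e\<close> kills \<open>f\<close>, it factors through \<open>c\<close>, so an arrow killed
  by \<open>c\<close> is killed by \<open>e\<close> and lifts uniquely along
  \<open>f\<close>.\<close>

lemma monic_is_kernel_of_cokernel:
  assumes f: "f \<in> Homs C X Y" "is_monic C f" and c: "c \<in> Homs C Y Q" "is_cokernel C f c"
  shows "is_kernel C c f"
  unfolding is_kernel_iff[OF c(1) f(1)]
proof (intro conjI ballI impI)
  show "c \<cdot> f = Zero C X Q" using c(2) unfolding is_cokernel_iff[OF f(1) c(1)] by blast
  fix W h assume W: "W \<in> Obj C" and h: "h \<in> Homs C W Y" and ch: "c \<cdot> h = Zero C W Q"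
  obtain e where ke: "is_kernel C e f" using monic_is_kernel[OF f(2)] by blast
  then have "e \<in> Arr C" "Cod C f = Dom C e" by (auto simp: is_kernel_def)
  then obtain Z where e: "e \<in> Homs C Y Z" using HomsD[OF f(1)] HomsI[of e C] by metis
  have Z: "Z \<in> Obj C" using Homs_Obj[OF e] by blast
  have "e \<cdot> f = Zero C X Z" using ke unfolding is_kernel_iff[OF e f(1)] by blast
  then obtain t where t: "t \<in> Homs C Q Z" "t \<cdot> c = e"
    using c(2) e Z unfolding is_cokernel_iff[OF f(1) c(1)] by metis
  have "e \<cdot> h = Zero C W Z"
    using Comp_assoc[OF h c(1) t(1)] t(2) ch Comp_Zero_right[OF t(1) W] by simp
  then show "\<exists>!u. u \<in> Homs C W X \<and> f \<cdot> u = h"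
    using ke h W unfolding is_kernel_iff[OF e f(1)] by blast
qed

text \<open>Exactness is defined through an image \<open>m\<close>, a kernel both of
  \<open>g\<close> and of a cokernel \<open>c\<close> of \<open>f\<close>. A monic \<open>f\<close>
  is itself a kernel of \<open>c\<close>, so \<open>f\<close> can take the place of
  \<open>m\<close>. All later arguments use the kernel-cokernel form.\<close>

lemma short_exact_iff:
  assumes f: "f \<in> Homs C X Y" and g: "g \<in> Homs C Y Z"
  shows "short_exact C f g \<longleftrightarrow> is_kernel C g f \<and> is_cokernel C f g"
proof
  assume "is_kernel C g f \<and> is_cokernel C f g"
  then show "short_exact C f g"
    using kernel_is_monic[OF g f] cokernel_is_epic[OF f g] HomsD[OF f] HomsD[OF g]
    unfolding short_exact_def exact_at_def is_image_def by auto
next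
  assume se: "short_exact C f g"
  then have mon: "is_monic C f" and epi: "is_epic C g" unfolding short_exact_def by auto
  obtain c m where cok: "is_cokernel C f c" and km: "is_kernel C c m" and kgm: "is_kernel C g m"
    using se unfolding short_exact_def exact_at_def is_image_def by blast
  obtain Q where c: "c \<in> Homs C Y Q"
    using cok HomsD[OF f] HomsI[of c C] unfolding is_cokernel_def by metis
  obtain K where m: "m \<in> Homs C K Y"
    using kgm HomsD[OF g] HomsI[of m C] unfolding is_kernel_def by metis
  have obj: "X \<in> Obj C" "Y \<in> Obj C" "Z \<in> Obj C" "K \<in> Obj C" "Q \<in> Obj C"
    using Homs_Obj[OF f] Homs_Obj[OF g] Homs_Obj[OF m] Homs_Obj[OF c] by auto
  note kcf = monic_is_kernel_of_cokernel[OF f mon c cok]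
  have "c \<cdot> f = Zero C X Q" using cok unfolding is_cokernel_iff[OF f c] by blast
  then obtain u where u: "u \<in> Homs C X K" "m \<cdot> u = f"
    using km f obj unfolding is_kernel_iff[OF c m] by metis
  have gm: "g \<cdot> m = Zero C K Z" using kgm unfolding is_kernel_iff[OF g m] by blast
  have cm: "c \<cdot> m = Zero C K Q" using km unfolding is_kernel_iff[OF c m] by blast
  have gf: "g \<cdot> f = Zero C X Z"
    using Comp_assoc[OF u(1) m g] u(2) gm Comp_Zero_left[OF u(1) obj(3)] by simp
  \<comment> \<open>Such an \<open>h\<close> lifts through \<open>m\<close>, is therefore killed by
    \<open>c\<close>, and so lifts through the kernel \<open>f\<close> of \<open>c\<close>.\<close>
  have lift: "\<exists>v\<in>Homs C W X. f \<cdot> v = h" if h: "h \<in> Homs C W Y" "g \<cdot> h = Zero C W Z" for W h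
  proof -
    have W: "W \<in> Obj C" using Homs_Obj[OF h(1)] by blast
    obtain w where w: "w \<in> Homs C W K" "m \<cdot> w = h"
      using kgm h W unfolding is_kernel_iff[OF g m] by metis
    have "c \<cdot> h = Zero C W Q"
      using Comp_assoc[OF w(1) m c] w(2) cm Comp_Zero_left[OF w(1) obj(5)] by simp
    then show ?thesis using kcf h(1) W unfolding is_kernel_iff[OF c f] by metis
  qed
  have "is_kernel C g f"
    unfolding is_kernel_iff[OF g f]
  proof (intro conjI ballI impI gf)
    fix W h assume W: "W \<in> Obj C" and h: "h \<in> Homs C W Y" "g \<cdot> h = Zero C W Z"
    obtain v where "v \<in> Homs C W X" "f \<cdot> v = h" using lift[OF h] by blast
    then show "\<exists>!u. u \<in> Homs C W X \<and> f \<cdot> u = h"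
      using mon W unfolding is_monic_iff[OF f] by metis
  qed
  moreover have "is_cokernel C f g"
    unfolding is_cokernel_iff[OF f g]
  proof (intro conjI ballI impI gf)
    fix W h assume W: "W \<in> Obj C" and h: "h \<in> Homs C Y W" "h \<cdot> f = Zero C X W"
    \<comment> \<open>The epic \<open>g\<close> is a cokernel of some \<open>e\<close>. Since
      \<open>g\<close> kills \<open>e\<close>, this \<open>e\<close> lifts through \<open>f\<close>;
      an \<open>h\<close> killing \<open>f\<close> thus kills \<open>e\<close> and factors through
      \<open>g\<close>.\<close>
    obtain e where ce: "is_cokernel C e g" using epic_is_cokernel[OF epi] by blast
    then obtain T where e: "e \<in> Homs C T Y"
      using HomsD[OF g] HomsI[of e C] unfolding is_cokernel_def by metis
    have T: "T \<in> Obj C" using Homs_Obj[OF e] by blast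
    have "g \<cdot> e = Zero C T Z" using ce unfolding is_cokernel_iff[OF e g] by blast
    then obtain v where v: "v \<in> Homs C T X" "f \<cdot> v = e" using lift[OF e] by blast
    have "h \<cdot> e = Zero C T W"
      using Comp_assoc[OF v(1) f h(1)] v(2) h(2) Comp_Zero_left[OF v(1) W] by simp
    then show "\<exists>!u. u \<in> Homs C Z W \<and> u \<cdot> g = h"
      using ce h(1) W unfolding is_cokernel_iff[OF e g] by blast
  qed
  ultimately show "is_kernel C g f \<and> is_cokernel C f g" by blast
qed

section \<open>Retracts as direct summands\<close>

text \<open>The complement of \<open>N\<close> is the kernel of \<open>h\<close>, split off by the
  idempotent \<open>e\<close> = 1 - \<open>g \<cdot> h\<close>.\<close>

lemma retract_is_biproduct:
  assumes g: "g \<in> Homs C N X" and h: "h \<in> Homs C X N" and hg: "h \<cdot> g = Ident C N"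
  shows "\<exists>K k q. is_biproduct C N K X g k h q"
proof -
  have N: "N \<in> Obj C" and X: "X \<in> Obj C" using Homs_Obj[OF g] by auto
  note gh = Comp_closed[OF h g]
  note I = Ident_closed[OF X]
  obtain n where n: "n \<in> Homs C X X" "Add C (g \<cdot> h) n = Zero C X X"
    using ex_negative[OF gh] by blast
  define e where "e = Add C (Ident C X) n"
  have e: "e \<in> Homs C X X" unfolding e_def using Add_closed[OF I n(1)] .
  have sum: "Add C (g \<cdot> h) e = Ident C X"
  proof -
    interpret G: comm_group "Hom_group C X X" using Hom_comm_group X by blast
    show ?thesis unfolding e_def
      using G.m_lcomm[of "g \<cdot> h" "Ident C X" n] G.r_one[of "Ident C X"] gh I n
      by (simp add: Hom_group_def)
  qed
  have he: "h \<cdot> e = Zero C X N"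
  proof -
    have "Add C h (h \<cdot> e) = h"
      using Comp_Add_right[OF gh e h] Comp_assoc[OF h g h] hg Comp_Ident_left[OF h]
        sum Comp_Ident_right[OF h] by simp
    then have "Add C h (h \<cdot> e) = Add C h (Zero C X N)" using Add_Zero(1)[OF h] by simp
    then show ?thesis using Add_left_cancel[OF h Comp_closed[OF e h] Zero_closed[OF X N]] by simp
  qed
  have eg: "e \<cdot> g = Zero C N X"
  proof -
    have "Add C g (e \<cdot> g) = g"
      using Comp_Add_left[OF g gh e] Comp_assoc[OF g h g] hg Comp_Ident_right[OF g]
        sum Comp_Ident_left[OF g] by simp
    then have "Add C g (e \<cdot> g) = Add C g (Zero C N X)" using Add_Zero(1)[OF g] by simp
    then show ?thesis using Add_left_cancel[OF g Comp_closed[OF g e] Zero_closed[OF N X]] by simp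
  qed
  obtain k where ker: "is_kernel C h k" using ex_kernel HomsD[OF h] by blast
  then obtain K where k: "k \<in> Homs C K X"
    using HomsD[OF h] HomsI[of k C] unfolding is_kernel_def by metis
  have K: "K \<in> Obj C" using Homs_Obj[OF k] by blast
  have hk: "h \<cdot> k = Zero C K N" using ker unfolding is_kernel_iff[OF h k] by blast
  \<comment> \<open>Since \<open>h\<close> kills \<open>e\<close>, the idempotent factors through
    the kernel; the factor is the projection onto the complement.\<close>
  obtain q where q: "q \<in> Homs C X K" "k \<cdot> q = e"
    using ker e he X unfolding is_kernel_iff[OF h k] by metis
  note mon = kernel_is_monic[OF h k ker]
  have "q \<cdot> g = Zero C N K"
    using monic_zero[OF k mon Comp_closed[OF g q(1)]] Comp_assoc[OF g q(1) k] q(2) eg by simp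
  moreover have "q \<cdot> k = Ident C K"
  proof -
    \<comment> \<open>On the kernel of \<open>h\<close> the summand \<open>g \<cdot> h\<close> of
      the identity vanishes, which leaves \<open>e\<close>.\<close>
    have "e \<cdot> k = k"
    proof -
      have "Add C ((g \<cdot> h) \<cdot> k) (e \<cdot> k) = k"
        using Comp_Add_left[OF k gh e] sum Comp_Ident_left[OF k] by simp
      then show ?thesis
        using Comp_assoc[OF k h g] hk Comp_Zero_right[OF g K] Add_Zero(2)[OF Comp_closed[OF k e]]
        by simp
    qed
    then have "k \<cdot> (q \<cdot> k) = k \<cdot> Ident C K"
      using Comp_assoc[OF k q(1) k] q(2) Comp_Ident_right[OF k] by simp
    then show ?thesis
      using mon Comp_closed[OF k q(1)] Ident_closed[OF K] K unfolding is_monic_iff[OF k] by blast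
  qed
  ultimately have "is_biproduct C N K X g k h q"
    unfolding is_biproduct_def using N K X g k h q hg hk sum by simp
  then show ?thesis by blast
qed

section \<open>Pushouts, vanishing of Ext and extension of arrows\<close>

text \<open>The pushout of \<open>f\<close> and \<open>a\<close> is built as the cokernel of
  \<open>u\<close> = (-\<open>a\<close>, \<open>f\<close>) from \<open>X\<close> to the biproduct of
  \<open>W\<close> and \<open>Y\<close>. The arrow to \<open>Z\<close> is induced by
  \<open>g\<close> on the summand \<open>Y\<close> and by zero on \<open>W\<close>.\<close>

lemma pushout_short_exact:
  assumes f: "f \<in> Homs C X Y" and g: "g \<in> Homs C Y Z" and se: "short_exact C f g"
    and a: "a \<in> Homs C X W"
  shows "\<exists>P i j g'. i \<in> Homs C W P \<and> j \<in> Homs C Y P \<and> g' \<in> Homs C P Z \<and>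
    i \<cdot> a = j \<cdot> f \<and> short_exact C i g'"
proof -
  have obj: "X \<in> Obj C" "Y \<in> Obj C" "Z \<in> Obj C" "W \<in> Obj C"
    using Homs_Obj[OF f] Homs_Obj[OF g] Homs_Obj[OF a] by auto
  have cok: "is_cokernel C f g" using se unfolding short_exact_iff[OF f g] by blast
  have gf: "g \<cdot> f = Zero C X Z" using cok unfolding is_cokernel_iff[OF f g] by blast
  have mon: "is_monic C f" and epi: "is_epic C g" using se unfolding short_exact_def by auto
  obtain B i j p q where bi: "is_biproduct C W Y B i j p q"
    using ex_biproduct obj by blast
  then have B: "B \<in> Obj C" and i: "i \<in> Homs C W B" and j: "j \<in> Homs C Y B"
    and p: "p \<in> Homs C B W" and q: "q \<in> Homs C B Y"
    and pi: "p \<cdot> i = Ident C W" and qj: "q \<cdot> j = Ident C Y" and qi: "q \<cdot> i = Zero C W Y"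
    and sum: "Add C (i \<cdot> p) (j \<cdot> q) = Ident C B"
    unfolding is_biproduct_def by auto
  \<comment> \<open>Here \<open>n\<close> is the negative of \<open>a\<close>, the first component
    of \<open>u\<close>.\<close>
  obtain n where n: "n \<in> Homs C X W" "Add C n a = Zero C X W"
    using ex_negative[OF a] by blast
  note i_n = Comp_closed[OF n(1) i]
  note j_f = Comp_closed[OF f j]
  define u where "u = Add C (i \<cdot> n) (j \<cdot> f)"
  have u: "u \<in> Homs C X B" unfolding u_def using Add_closed[OF i_n j_f] .
  have qu: "q \<cdot> u = f"
    unfolding u_def
    using Comp_Add_right[OF i_n j_f q] Comp_assoc[OF n(1) i q] Comp_assoc[OF f j q] qi qj
      Comp_Zero_left[OF n(1) obj(2)] Comp_Ident_left[OF f] Add_Zero(2)[OF f] by simp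
  \<comment> \<open>The component \<open>q \<cdot> u\<close> is the monic \<open>f\<close>.\<close>
  have monu: "is_monic C u"
  proof (rule is_monicI[OF u])
    fix T h assume h: "h \<in> Homs C T X" and uh: "u \<cdot> h = Zero C T B"
    have "T \<in> Obj C" using Homs_Obj[OF h] by blast
    then have "f \<cdot> h = Zero C T Y"
      using Comp_assoc[OF h u q] qu uh Comp_Zero_right[OF q] by simp
    then show "h = Zero C T X" using monic_zero[OF f mon h] by blast
  qed
  obtain c where cu: "is_cokernel C u c" using ex_cokernel HomsD[OF u] by blast
  then obtain P where c: "c \<in> Homs C B P"
    using HomsD[OF u] HomsI[of c C] unfolding is_cokernel_def by metis
  have P: "P \<in> Obj C" using Homs_Obj[OF c] by blast
  note epc = cokernel_is_epic[OF u c cu]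
  note kcu = monic_is_kernel_of_cokernel[OF u monu c cu]
  have cu0: "c \<cdot> u = Zero C X P" using cu unfolding is_cokernel_iff[OF u c] by blast
  define i' j' where "i' = c \<cdot> i" and "j' = c \<cdot> j"
  have i': "i' \<in> Homs C W P" and j': "j' \<in> Homs C Y P"
    unfolding i'_def j'_def using Comp_closed[OF i c] Comp_closed[OF j c] by auto
  \<comment> \<open>Both sides are negatives of \<open>i' \<cdot> n\<close>.\<close>
  have square: "i' \<cdot> a = j' \<cdot> f"
  proof -
    have "Add C (i' \<cdot> n) (j' \<cdot> f) = Zero C X P"
      using cu0 Comp_Add_right[OF i_n j_f c] Comp_assoc[OF n(1) i c] Comp_assoc[OF f j c]
      unfolding u_def i'_def j'_def by simp
    moreover have "Add C (i' \<cdot> n) (i' \<cdot> a) = Zero C X P"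
      using Comp_Add_right[OF n(1) a i'] n(2) Comp_Zero_right[OF i' obj(1)] by simp
    ultimately show ?thesis
      using Add_left_cancel[OF Comp_closed[OF n(1) i'] Comp_closed[OF a i'] Comp_closed[OF f j']]
      by simp
  qed
  \<comment> \<open>If \<open>i'\<close> kills \<open>x\<close>, then \<open>i \<cdot> x\<close>
    lies in the kernel of \<open>c\<close> and lifts to some \<open>y\<close> along
    \<open>u\<close>. Projecting by \<open>q\<close> gives \<open>f \<cdot> y\<close> = 0, so
    \<open>y\<close> is zero; projecting by \<open>p\<close> then gives that \<open>x\<close> is
    zero.\<close>
  have moni: "is_monic C i'"
  proof (rule is_monicI[OF i'])
    fix T x assume x: "x \<in> Homs C T W" and "i' \<cdot> x = Zero C T P"
    then have T: "T \<in> Obj C" and "c \<cdot> (i \<cdot> x) = Zero C T P"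
      using Homs_Obj[OF x] Comp_assoc[OF x i c] unfolding i'_def by auto
    then obtain y where y: "y \<in> Homs C T X" "u \<cdot> y = i \<cdot> x"
      using kcu Comp_closed[OF x i] unfolding is_kernel_iff[OF c u] by metis
    have "f \<cdot> y = Zero C T Y"
      using Comp_assoc[OF y(1) u q] qu y(2) Comp_assoc[OF x i q] qi Comp_Zero_left[OF x obj(2)]
      by simp
    then have "y = Zero C T X" using monic_zero[OF f mon y(1)] by blast
    then have "i \<cdot> x = Zero C T B" using y(2) Comp_Zero_right[OF u T] by simp
    then show "x = Zero C T W"
      using Comp_assoc[OF x i p] pi Comp_Ident_left[OF x] Comp_Zero_right[OF p T] by simp
  qed
  note gq = Comp_closed[OF q g]
  have "(g \<cdot> q) \<cdot> u = Zero C X Z" using Comp_assoc[OF u q g] qu gf by simp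
  then obtain g' where g': "g' \<in> Homs C P Z" "g' \<cdot> c = g \<cdot> q"
    using cu gq obj(3) unfolding is_cokernel_iff[OF u c] by metis
  have g'i: "g' \<cdot> i' = Zero C W Z"
    unfolding i'_def
    using Comp_assoc[OF i c g'(1)] g'(2) Comp_assoc[OF i q g] qi Comp_Zero_right[OF g obj(4)]
    by simp
  have g'j: "g' \<cdot> j' = g"
    unfolding j'_def
    using Comp_assoc[OF j c g'(1)] g'(2) Comp_assoc[OF j q g] qj Comp_Ident_right[OF g] by simp
  have cok': "is_cokernel C i' g'"
    unfolding is_cokernel_iff[OF i' g'(1)]
  proof (intro conjI ballI impI g'i)
    fix T h assume T: "T \<in> Obj C" and h: "h \<in> Homs C P T" and hi: "h \<cdot> i' = Zero C W T"
    \<comment> \<open>The commuting square shows that \<open>h \<cdot> j'\<close> kills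
      \<open>f\<close>, which yields the factor \<open>t\<close> through \<open>g\<close>.\<close>
    note hj = Comp_closed[OF j' h]
    have "(h \<cdot> j') \<cdot> f = Zero C X T"
      using Comp_assoc[OF f j' h] Comp_assoc[OF a i' h] square hi Comp_Zero_left[OF a T] by simp
    then obtain t where t: "t \<in> Homs C Z T" "t \<cdot> g = h \<cdot> j'"
      using cok hj T unfolding is_cokernel_iff[OF f g] by metis
    note hc = Comp_closed[OF c h]
    note ip = Comp_closed[OF p i]
    note jq = Comp_closed[OF q j]
    \<comment> \<open>To compare \<open>t \<cdot> g'\<close> with \<open>h\<close>, both are
      precomposed with the epic \<open>c\<close>, and \<open>h \<cdot> c\<close> is decomposed along
      the biproduct; the part on \<open>W\<close> vanishes because \<open>h\<close> kills
      \<open>i'\<close>.\<close>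
    have "h \<cdot> c = Add C ((h \<cdot> c) \<cdot> (i \<cdot> p)) ((h \<cdot> c) \<cdot> (j \<cdot> q))"
      using Comp_Add_right[OF ip jq hc] sum Comp_Ident_right[OF hc] by simp
    also have "(h \<cdot> c) \<cdot> (i \<cdot> p) = Zero C B T"
      using Comp_assoc[OF p i hc] Comp_assoc[OF i c h] hi Comp_Zero_left[OF p T]
      unfolding i'_def by simp
    also have "(h \<cdot> c) \<cdot> (j \<cdot> q) = (t \<cdot> g') \<cdot> c"
      using Comp_assoc[OF q j hc] Comp_assoc[OF j c h] t(2) Comp_assoc[OF q g t(1)]
        g'(2) Comp_assoc[OF c g'(1) t(1)]
      unfolding j'_def by simp
    finally have "(t \<cdot> g') \<cdot> c = h \<cdot> c"
      using Add_Zero(2)[OF Comp_closed[OF c Comp_closed[OF g'(1) t(1)]]] by simp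
    then have th: "t \<cdot> g' = h"
      using epc h Comp_closed[OF g'(1) t(1)] T unfolding is_epic_iff[OF c] by blast
    show "\<exists>!v. v \<in> Homs C Z T \<and> v \<cdot> g' = h"
    proof (rule ex1I[of _ t])
      fix v assume v: "v \<in> Homs C Z T \<and> v \<cdot> g' = h"
      \<comment> \<open>Precomposing with \<open>j'\<close> turns \<open>g'\<close> into the epic
        \<open>g\<close>.\<close>
      have "v \<cdot> g = t \<cdot> g"
        using v th Comp_assoc[OF j' g'(1), of v T] Comp_assoc[OF j' g'(1) t(1)] g'j by metis
      then show "v = t" using epi v t(1) T unfolding is_epic_iff[OF g] by blast
    qed (use t th in auto)
  qed
  have "short_exact C i' g'"
    using monic_is_kernel_of_cokernel[OF i' moni g'(1) cok'] cok' short_exact_iff[OF i' g'(1)]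
    by blast
  then show ?thesis using i' j' g' square by blast
qed

text \<open>The class of the sequence must be the only element \<open>Ext1_zero C M X\<close> of
  \<open>Ext1 C M X\<close>. It contains the sequence by reflexivity, so the sequence itself is a
  biproduct sequence, whose projection is the retraction.\<close>

lemma Ext1_vanishes_split:
  assumes van: "Ext1_vanishes C M X" and se: "short_exact C f g"
    and f: "f \<in> Homs C X E" and g: "g \<in> Homs C E M"
  shows "\<exists>p\<in>Homs C E X. p \<cdot> f = Ident C X"
proof -
  have E: "E \<in> Obj C" using Homs_Obj[OF f] by blast
  have ext: "(f, g) \<in> extensions C M X"
    using se HomsD[OF f] HomsD[OF g] unfolding extensions_def by auto
  have iso: "is_isomorphism C (Ident C E)"
    using Ident_closed[OF E] Comp_Ident_left[OF Ident_closed[OF E]] HomsD[OF Ident_closed[OF E]]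
    unfolding is_isomorphism_def by auto
  have "((f, g), (f, g)) \<in> extension_equiv C M X"
    using ext iso Ident_closed[OF E] Comp_Ident_left[OF f] Comp_Ident_right[OF g] HomsD[OF f]
    unfolding extension_equiv_def by auto
  moreover have "extension_equiv C M X `` {(f, g)} \<in> Ext1 C M X"
    using ext unfolding Ext1_def by (rule quotientI)
  ultimately have "(f, g) \<in> Ext1_zero C M X"
    using van unfolding Ext1_vanishes_def by auto
  then obtain B j p where bi: "is_biproduct C X M B f j p g"
    unfolding Ext1_zero_def by blast
  \<comment> \<open>The biproduct object is determined as the codomain of \<open>f\<close>.\<close>
  then have "B = E" using HomsD[OF f] HomsD[of f C X B] unfolding is_biproduct_def by auto
  then show ?thesis using bi unfolding is_biproduct_def by blast
qed

text \<open>The obstruction to extending \<open>a\<close> along \<open>f\<close> is the class of the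
  pushout sequence in \<open>Ext1 C Z W\<close>.\<close>

lemma Ext1_vanishes_extends:
  assumes f: "f \<in> Homs C X Y" and g: "g \<in> Homs C Y Z" and se: "short_exact C f g"
    and van: "Ext1_vanishes C Z W" and a: "a \<in> Homs C X W"
  shows "\<exists>b\<in>Homs C Y W. b \<cdot> f = a"
proof -
  obtain P i j g' where P: "i \<in> Homs C W P" "j \<in> Homs C Y P" "g' \<in> Homs C P Z"
    "i \<cdot> a = j \<cdot> f" "short_exact C i g'"
    using pushout_short_exact[OF f g se a] by blast
  obtain p where p: "p \<in> Homs C P W" "p \<cdot> i = Ident C W"
    using Ext1_vanishes_split[OF van P(5,1,3)] by blast
  have "(p \<cdot> j) \<cdot> f = a"
    using Comp_assoc[OF f P(2) p(1)] P(4) Comp_assoc[OF a P(1) p(1)] p(2) Comp_Ident_left[OF a]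
    by simp
  then show ?thesis using Comp_closed[OF P(2) p(1)] by blast
qed

section \<open>Hom-exactness of sequences with cokernel in the left perpendicular class\<close>

lemma Hom_functor_hom:
  assumes f: "f \<in> Homs C X Y" and W: "W \<in> Obj C"
  shows "(\<lambda>h. h \<cdot> f) \<in> hom (Hom_group C Y W) (Hom_group C X W)"
  using Comp_closed[OF f] Comp_Add_left[OF f] by (auto simp: hom_def Hom_group_def)

text \<open>Injectivity and exactness in the middle restate that \<open>g\<close> is a cokernel of
  \<open>f\<close>; vanishing of Ext enters through surjectivity of restriction along
  \<open>f\<close>.\<close>

lemma short_exact_Ext1_vanishes_Hom_exact:
  assumes f: "f \<in> Homs C X Y" and g: "g \<in> Homs C Y Z" and se: "short_exact C f g"
    and van: "\<And>W. W \<in> V \<Longrightarrow> Ext1_vanishes C Z W" and V: "V \<subseteq> Obj C"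
  shows "Hom_exact C V f g"
  unfolding Hom_exact_def Let_def
proof (intro conjI ballI se)
  fix W assume WV: "W \<in> V"
  then have W: "W \<in> Obj C" using V by blast
  have obj: "X \<in> Obj C" "Y \<in> Obj C" "Z \<in> Obj C"
    using Homs_Obj[OF f] Homs_Obj[OF g] by auto
  have [simp]: "Dom C f = X" "Cod C f = Y" "Dom C g = Y" "Cod C g = Z"
    using HomsD[OF f] HomsD[OF g] by auto
  have cok: "is_cokernel C f g" using se unfolding short_exact_iff[OF f g] by blast
  have gf: "g \<cdot> f = Zero C X Z" using cok unfolding is_cokernel_iff[OF f g] by blast
  have group: "group (Hom_group C T W)" if "T \<in> Obj C" for T
    using comm_group.axioms(2)[OF Hom_comm_group[OF that W]] .
  show "inj_on (FMap (Hom_functor C W) g) (carrier (FObj (Hom_functor C W) (Cod C g)))"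
    using cokernel_is_epic[OF f g cok] W unfolding is_epic_iff[OF g] inj_on_def
    by (auto simp: Hom_functor_def Hom_group_def)
  show "FMap (Hom_functor C W) f ` carrier (FObj (Hom_functor C W) (Cod C f))
      = carrier (FObj (Hom_functor C W) (Dom C f))"
  proof -
    have "(\<lambda>h. h \<cdot> f) ` Homs C Y W = Homs C X W"
    proof (intro equalityI subsetI)
      fix a assume "a \<in> Homs C X W"
      then show "a \<in> (\<lambda>h. h \<cdot> f) ` Homs C Y W"
        using Ext1_vanishes_extends[OF f g se van[OF WV]] by blast
    qed (use Comp_closed[OF f] in auto)
    then show ?thesis by (simp add: Hom_functor_def Hom_group_def)
  qed
  have "kernel (Hom_group C Y W) (Hom_group C X W) (\<lambda>h. h \<cdot> f)
      = (\<lambda>h. h \<cdot> g) ` carrier (Hom_group C Z W)"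
  proof (intro equalityI subsetI)
    fix h assume "h \<in> kernel (Hom_group C Y W) (Hom_group C X W) (\<lambda>h. h \<cdot> f)"
    then have "h \<in> Homs C Y W" "h \<cdot> f = Zero C X W" by (auto simp: kernel_def Hom_group_def)
    then have "\<exists>!u. u \<in> Homs C Z W \<and> u \<cdot> g = h"
      using cok W unfolding is_cokernel_iff[OF f g] by blast
    then show "h \<in> (\<lambda>h. h \<cdot> g) ` carrier (Hom_group C Z W)"
      by (auto simp: Hom_group_def)
  next
    fix h assume "h \<in> (\<lambda>h. h \<cdot> g) ` carrier (Hom_group C Z W)"
    then obtain t where t: "t \<in> Homs C Z W" "h = t \<cdot> g" by (auto simp: Hom_group_def)
    have "h \<cdot> f = Zero C X W"
      using Comp_assoc[OF f g t(1)] t(2) gf Comp_Zero_right[OF t(1) obj(1)] by simp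
    then show "h \<in> kernel (Hom_group C Y W) (Hom_group C X W) (\<lambda>h. h \<cdot> f)"
      using Comp_closed[OF g t(1)] t(2) by (simp add: kernel_def Hom_group_def)
  qed
  then show "exact_seq ([FObj (Hom_functor C W) (Dom C f), FObj (Hom_functor C W) (Cod C f),
      FObj (Hom_functor C W) (Cod C g)], [FMap (Hom_functor C W) f, FMap (Hom_functor C W) g])"
    using Hom_functor_hom[OF f W] Hom_functor_hom[OF g W] group obj
    by (simp add: Hom_functor_def group_hom_def group_hom_axioms_def)
qed

section \<open>Arrows factoring through the subcategory\<close>

lemma factoring_subset_Homs:
  "factoring C V M N \<subseteq> Homs C M N"
  using Comp_closed by (auto simp: factoring_def)

lemma Zero_in_factoring:
  assumes "additive_subcategory C V" "M \<in> Obj C" "N \<in> Obj C"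
  shows "Zero C M N \<in> factoring C V M N"
proof -
  obtain Z where Z: "Z \<in> V" "Z \<in> Obj C"
    using assms(1) unfolding additive_subcategory_def by auto
  have "Zero C Z N \<cdot> Zero C M Z = Zero C M N"
    using Comp_Zero_left[OF Zero_closed[OF assms(2) Z(2)] assms(3)] .
  then show ?thesis
    using Z Zero_closed[OF assms(2) Z(2)] Zero_closed[OF Z(2) assms(3)]
    unfolding factoring_def by (auto intro!: exI)
qed

text \<open>Factorizations through \<open>X\<close> and \<open>Y\<close> combine to one through
  their biproduct, which can be chosen in \<open>V\<close>.\<close>

lemma factoring_Add:
  assumes add: "additive_subcategory C V"
    and "x \<in> factoring C V M N" "y \<in> factoring C V M N"
  shows "Add C x y \<in> factoring C V M N"
proof -
  obtain g h X where x: "x = h \<cdot> g" "X \<in> V" and g: "g \<in> Homs C M X" and h: "h \<in> Homs C X N"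
    using assms(2) unfolding factoring_def by blast
  obtain g' h' Y where y: "y = h' \<cdot> g'" "Y \<in> V" and g': "g' \<in> Homs C M Y" and h': "h' \<in> Homs C Y N"
    using assms(3) unfolding factoring_def by blast
  obtain B i j p q where B: "B \<in> V" and bi: "is_biproduct C X Y B i j p q"
    using add x(2) y(2) unfolding additive_subcategory_def by meson
  have i: "i \<in> Homs C X B" and j: "j \<in> Homs C Y B" and p: "p \<in> Homs C B X" and q: "q \<in> Homs C B Y"
    and eqs: "p \<cdot> i = Ident C X" "q \<cdot> j = Ident C Y" "p \<cdot> j = Zero C Y X" "q \<cdot> i = Zero C X Y"
    using bi unfolding is_biproduct_def by auto
  have obj: "X \<in> Obj C" "Y \<in> Obj C" using Homs_Obj[OF h] Homs_Obj[OF h'] by auto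
  note ig = Comp_closed[OF g i]
  note jg = Comp_closed[OF g' j]
  note hp = Comp_closed[OF p h]
  note hq = Comp_closed[OF q h']
  \<comment> \<open>This is the arrow to the biproduct with components \<open>g\<close> and
    \<open>g'\<close>.\<close>
  let ?d = "Add C (i \<cdot> g) (j \<cdot> g')"
  have d: "?d \<in> Homs C M B" using Add_closed[OF ig jg] .
  have pd: "p \<cdot> ?d = g"
    using Comp_Add_right[OF ig jg p] Comp_assoc[OF g i p] Comp_assoc[OF g' j p] eqs
      Comp_Ident_left[OF g] Comp_Zero_left[OF g' obj(1)] Add_Zero(1)[OF g] by simp
  have qd: "q \<cdot> ?d = g'"
    using Comp_Add_right[OF ig jg q] Comp_assoc[OF g i q] Comp_assoc[OF g' j q] eqs
      Comp_Ident_left[OF g'] Comp_Zero_left[OF g obj(2)] Add_Zero(2)[OF g'] by simp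
  have "Add C (h \<cdot> p) (h' \<cdot> q) \<cdot> ?d = Add C x y"
    using Comp_Add_left[OF d hp hq] Comp_assoc[OF d p h] Comp_assoc[OF d q h'] pd qd x(1) y(1)
    by simp
  then show ?thesis
    using B d Add_closed[OF hp hq] unfolding factoring_def by (auto intro!: exI)
qed

text \<open>An arrow into an object of \<open>V\<close> factors through its own codomain, by the
  identity. The stable Hom group is then a group modulo itself.\<close>

lemma factoring_eq_Homs:
  assumes N: "N \<in> V"
  shows "factoring C V M N = Homs C M N"
proof (intro equalityI factoring_subset_Homs subsetI)
  fix h assume h: "h \<in> Homs C M N"
  then have "N \<in> Obj C" using Homs_Obj by blast
  then have "\<exists>g k X. h = k \<cdot> g \<and> X \<in> V \<and> g \<in> Homs C M X \<and> k \<in> Homs C X N"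
    using N h Comp_Ident_left[OF h] Ident_closed by metis
  then show "h \<in> factoring C V M N" unfolding factoring_def by blast
qed

lemma Ident_in_factoring_imp_mem:
  assumes "closed_under_direct_summands C V" "Ident C N \<in> factoring C V N N"
  shows "N \<in> V"
proof -
  obtain g h X where "Ident C N = h \<cdot> g" "X \<in> V" "g \<in> Homs C N X" "h \<in> Homs C X N"
    using assms(2) unfolding factoring_def by blast
  then show ?thesis
    using retract_is_biproduct[of g N X h] assms(1)
    unfolding closed_under_direct_summands_def by metis
qed

text \<open>The representative is recovered as 0 + \<open>h\<close>, so equations between cosets
  yield statements about arrows.\<close>

lemma mem_factoring_coset:
  assumes "additive_subcategory C V" "h \<in> Homs C M N"
  shows "h \<in> factoring C V M N #>\<^bsub>Hom_group C M N\<^esub> h"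
  using Zero_in_factoring[OF assms(1), of M N] Homs_Obj[OF assms(2)] Add_Zero(2)[OF assms(2)]
  unfolding r_coset_def by (force simp: Hom_group_def)

lemma trivial_stable_Hom_Ident:
  assumes "additive_subcategory C V" "N \<in> Obj C" "trivial_group (stable_Hom C V N N)"
  shows "Ident C N \<in> factoring C V N N"
proof -
  note I = Ident_closed[OF assms(2)]
  have "factoring C V N N #>\<^bsub>Hom_group C N N\<^esub> Ident C N \<in> carrier (stable_Hom C V N N)"
    using I unfolding stable_Hom_def carrier_FactGroup by (simp add: Hom_group_def)
  \<comment> \<open>The neutral element of the quotient is the subgroup itself.\<close>
  then have "factoring C V N N #>\<^bsub>Hom_group C N N\<^esub> Ident C N = factoring C V N N"
    using assms(3) unfolding trivial_group_def stable_Hom_def by simp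
  then show ?thesis using mem_factoring_coset[OF assms(1) I] by simp
qed

section \<open>The stable Hom functor into an object of the subcategory\<close>

lemma Homs_coset:
  assumes "h \<in> Homs C M N"
  shows "Homs C M N #>\<^bsub>Hom_group C M N\<^esub> h = Homs C M N"
proof -
  interpret G: comm_group "Hom_group C M N" using Hom_comm_group Homs_Obj[OF assms] by blast
  show ?thesis
    using G.coset_join2[OF _ G.subgroup_self] assms by (simp add: Hom_group_def)
qed

lemma carrier_stable_Hom:
  assumes "N \<in> V" "N \<in> Obj C" "M \<in> Obj C"
  shows "carrier (stable_Hom C V M N) = {Homs C M N}"
  using Zero_closed[OF assms(3,2)] Homs_coset[of _ M N]
  unfolding stable_Hom_def carrier_FactGroup factoring_eq_Homs[OF assms(1)]
  by (auto simp: Hom_group_def)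

lemma comm_group_stable_Hom:
  assumes "N \<in> V" "N \<in> Obj C" "M \<in> Obj C"
  shows "comm_group (stable_Hom C V M N)"
proof -
  interpret G: comm_group "Hom_group C M N" using Hom_comm_group assms by blast
  show ?thesis
    using G.abelian_FactGroup[OF G.subgroup_self]
    unfolding stable_Hom_def factoring_eq_Homs[OF assms(1)] by (simp add: Hom_group_def)
qed

lemma trivial_stable_Hom:
  assumes "N \<in> V" "N \<in> Obj C" "M \<in> Obj C"
  shows "trivial_group (stable_Hom C V M N)"
  using carrier_stable_Hom[OF assms] comm_group_stable_Hom[OF assms]
  unfolding trivial_group_def comm_group_def
  by (simp add: stable_Hom_def factoring_eq_Homs[OF assms(1)])

lemma FMap_stable_Hom:
  assumes f: "f \<in> Homs C X Y" and N: "N \<in> V" "N \<in> Obj C"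
  shows "FMap (stable_Hom_functor C V N) f (Homs C Y N) = Homs C X N"
proof -
  \<comment> \<open>\<open>FMap\<close> is a union over representatives; it collapses to the common
    coset only if there is a representative.\<close>
  have "Homs C Y N \<noteq> {}" using Zero_closed[of Y N] N Homs_Obj[OF f] by blast
  moreover have "Dom C f = X" using HomsD[OF f] by blast
  ultimately show ?thesis
    using Homs_coset Comp_closed[OF f]
    by (simp add: stable_Hom_functor_def factoring_eq_Homs[OF N(1)])
qed

text \<open>All value groups have a single element, namely the full Hom set, so each functor law
  compares that element with itself.\<close>

lemma additive_stable_Hom_functor:
  assumes N: "N \<in> V" "N \<in> Obj C"
  shows "additive_cofunctor C (stable_Hom_functor C V N)"
proof -
  let ?F = "stable_Hom_functor C V N"
  have obj: "FObj ?F X = stable_Hom C V X N" for X by (simp add: stable_Hom_functor_def)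
  have carr: "carrier (FObj ?F X) = {Homs C X N}" if "X \<in> Obj C" for X
    using carrier_stable_Hom[OF N that] by (simp add: obj)
  have mult: "Homs C X N \<otimes>\<^bsub>FObj ?F X\<^esub> Homs C X N = Homs C X N" if "X \<in> Obj C" for X
  proof -
    interpret G: comm_group "FObj ?F X" using comm_group_stable_Hom[OF N that] by (simp add: obj)
    show ?thesis using G.m_closed[of "Homs C X N" "Homs C X N"] carr[OF that] by simp
  qed
  show ?thesis
    unfolding additive_cofunctor_def
  proof (intro conjI ballI impI)
    fix X assume X: "X \<in> Obj C"
    show "comm_group (FObj ?F X)" using comm_group_stable_Hom[OF N X] by (simp add: obj)
    fix x assume "x \<in> carrier (FObj ?F X)"
    then show "FMap ?F (Ident C X) x = x"
      using carr[OF X] FMap_stable_Hom[OF Ident_closed[OF X] N] by simp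
  next
    fix f assume "f \<in> Arr C"
    then show "FMap ?F f \<in> hom (FObj ?F (Cod C f)) (FObj ?F (Dom C f))"
      using carr Dom_closed Cod_closed FMap_stable_Hom[OF HomsI N] mult by (simp add: hom_def)
  next
    fix f g x assume f: "f \<in> Arr C" and g: "g \<in> Arr C" and eq: "Cod C f = Dom C g"
      and x: "x \<in> carrier (FObj ?F (Cod C g))"
    have f': "f \<in> Homs C (Dom C f) (Dom C g)" using HomsI[OF f] eq by simp
    show "FMap ?F (g \<cdot> f) x = FMap ?F f (FMap ?F g x)"
      using x carr[OF Cod_closed[OF g]] FMap_stable_Hom[OF f' N] FMap_stable_Hom[OF HomsI[OF g] N]
        FMap_stable_Hom[OF Comp_closed[OF f' HomsI[OF g]] N] by simp
  next
    fix X Y f f' x assume X: "X \<in> Obj C" and Y: "Y \<in> Obj C" and f: "f \<in> Homs C X Y"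
      and f': "f' \<in> Homs C X Y" and x: "x \<in> carrier (FObj ?F Y)"
    show "FMap ?F (Add C f f') x = FMap ?F f x \<otimes>\<^bsub>FObj ?F X\<^esub> FMap ?F f' x"
      using x carr[OF Y] FMap_stable_Hom[OF f N] FMap_stable_Hom[OF f' N]
        FMap_stable_Hom[OF Add_closed[OF f f'] N] mult[OF X] by simp
  qed
qed

lemma right_Hom_exact_stable_Hom_functor:
  assumes N: "N \<in> V" "N \<in> Obj C"
  shows "right_Hom_exact C V (stable_Hom_functor C V N)"
  unfolding right_Hom_exact_def
proof (intro conjI allI impI additive_stable_Hom_functor[OF N])
  let ?F = "stable_Hom_functor C V N"
  have obj: "FObj ?F X = stable_Hom C V X N" for X by (simp add: stable_Hom_functor_def)
  have carr: "carrier (FObj ?F X) = {Homs C X N}" if "X \<in> Obj C" for X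
    using carrier_stable_Hom[OF N that] by (simp add: obj)
  have group: "group (FObj ?F X)" if "X \<in> Obj C" for X
    using comm_group_stable_Hom[OF N that] by (simp add: obj comm_group_def)
  have one: "\<one>\<^bsub>FObj ?F X\<^esub> = Homs C X N" for X
    by (simp add: obj stable_Hom_def factoring_eq_Homs[OF N(1)])
  have hom: "FMap ?F f \<in> hom (FObj ?F (Cod C f)) (FObj ?F (Dom C f))" if "f \<in> Arr C" for f
    using additive_stable_Hom_functor[OF N] that unfolding additive_cofunctor_def by blast
  fix f g assume "Hom_exact C V f g"
  then have f: "f \<in> Arr C" and g: "g \<in> Arr C" and eq: "Cod C f = Dom C g"
    unfolding Hom_exact_def short_exact_def is_monic_def is_epic_def by auto
  have f': "f \<in> Homs C (Dom C f) (Dom C g)" using HomsI[OF f] eq by simp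
  note maps = FMap_stable_Hom[OF f' N] FMap_stable_Hom[OF HomsI[OF g] N]
  note carrs = carr[OF Dom_closed[OF f]] carr[OF Dom_closed[OF g]] carr[OF Cod_closed[OF g]]
  show "FMap ?F f ` carrier (FObj ?F (Cod C f)) = carrier (FObj ?F (Dom C f))"
    using maps carrs eq by simp
  \<comment> \<open>Kernel and image are both the whole one-element group.\<close>
  have "kernel (FObj ?F (Cod C f)) (FObj ?F (Dom C f)) (FMap ?F f)
      = FMap ?F g ` carrier (FObj ?F (Cod C g))"
    using maps carrs eq one by (auto simp: kernel_def)
  then show "exact_seq ([FObj ?F (Dom C f), FObj ?F (Cod C f), FObj ?F (Cod C g)],
      [FMap ?F f, FMap ?F g])"
    using hom[OF f] hom[OF g] group Dom_closed[OF f] Dom_closed[OF g] Cod_closed[OF g] eq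
    by (simp add: group_hom_def group_hom_axioms_def)
qed

section \<open>From right exactness to membership\<close>

lemma right_Hom_exact_imp_mem:
  assumes add: "additive_subcategory C V" and spe: "special_preenveloping C V"
    and sum: "closed_under_direct_summands C V" and N: "N \<in> Obj C"
    and right: "right_Hom_exact C V (stable_Hom_functor C V N)"
  shows "N \<in> V"
proof -
  let ?F = "stable_Hom_functor C V N"
  have V: "V \<subseteq> Obj C" using add unfolding additive_subcategory_def by blast
  obtain f g where se: "short_exact C f g" and dom: "Dom C f = N" and Y: "Cod C f \<in> V"
    and perp: "Cod C g \<in> left_Ext_perp C V"
    using spe N unfolding special_preenveloping_def by blast
  have f: "f \<in> Homs C N (Cod C f)" and g: "g \<in> Homs C (Cod C f) (Cod C g)"
    using se dom unfolding short_exact_def is_monic_def is_epic_def Homs_def by auto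
  have "Hom_exact C V f g"
    using short_exact_Ext1_vanishes_Hom_exact[OF f g se _ V] perp unfolding left_Ext_perp_def
    by blast
  then have surj: "FMap ?F f ` carrier (FObj ?F (Cod C f)) = carrier (FObj ?F N)"
    using right dom unfolding right_Hom_exact_def by blast
  note I = Ident_closed[OF N]
  let ?I = "factoring C V N N #>\<^bsub>Hom_group C N N\<^esub> Ident C N"
  have "?I \<in> carrier (FObj ?F N)"
    using I by (simp add: stable_Hom_functor_def stable_Hom_def carrier_FactGroup Hom_group_def)
  \<comment> \<open>Surjectivity at the left end of the special preenvelope gives a preimage of the
    class of the identity.\<close>
  then obtain K where "K \<in> carrier (FObj ?F (Cod C f))" and IK: "?I = FMap ?F f K"
    unfolding surj[symmetric] by blast
  then have K: "K \<in> carrier (stable_Hom C V (Cod C f) N)" by (simp add: stable_Hom_functor_def)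
  obtain k where k: "k \<in> Homs C (Cod C f) N"
    and Kk: "K = factoring C V (Cod C f) N #>\<^bsub>Hom_group C (Cod C f) N\<^esub> k"
    using K by (auto simp: stable_Hom_def carrier_FactGroup Hom_group_def)
  have Khom: "K \<subseteq> Homs C (Cod C f) N"
    using Kk Add_closed k factoring_subset_Homs unfolding r_coset_def
    by (fastforce simp: Hom_group_def)
  have "Ident C N \<in> FMap ?F f K" using mem_factoring_coset[OF add I] IK by simp
  \<comment> \<open>Passing to representatives writes the identity as \<open>d\<close> +
    \<open>h \<cdot> f\<close>. Here \<open>h \<cdot> f\<close> factors through
    \<open>Cod C f\<close>, which lies in \<open>V\<close>; in this form the vanishing of the stable
    group at the envelope is used.\<close>
  then obtain h d where h: "h \<in> K" and d: "d \<in> factoring C V N N"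
    and eq: "Ident C N = Add C d (h \<cdot> f)"
    by (auto simp: stable_Hom_functor_def r_coset_def Hom_group_def dom)
  have "h \<cdot> f \<in> factoring C V N N"
    using h Khom f Y unfolding factoring_def by blast
  then have "Ident C N \<in> factoring C V N N" using factoring_Add[OF add d] eq by simp
  then show ?thesis by (rule Ident_in_factoring_imp_mem[OF sum])
qed

end

theorem corollary2p16:
  fixes A :: "('o, 'm) precat" and V :: "'o set" and N :: 'o
  assumes "abelian_category A"
    and "additive_subcategory A V"
    and "special_preenveloping A V"
    and "closed_under_direct_summands A V"
    and "N \<in> Obj A"
  shows "(right_Hom_exact A V (stable_Hom_functor A V N)
            \<longleftrightarrow> (\<forall>M\<in>Obj A. trivial_group (stable_Hom A V M N))) \<and>
         ((\<forall>M\<in>Obj A. trivial_group (stable_Hom A V M N)) \<longleftrightarrow> N \<in> V)"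
proof -
  interpret abelian_category A by fact
  have "right_Hom_exact A V (stable_Hom_functor A V N) \<longleftrightarrow> N \<in> V"
    using right_Hom_exact_imp_mem right_Hom_exact_stable_Hom_functor assms(2-5) by blast
  \<comment> \<open>For the forward direction take \<open>M\<close> = \<open>N\<close>, where the
    class of the identity has to vanish.\<close>
  moreover have "(\<forall>M\<in>Obj A. trivial_group (stable_Hom A V M N)) \<longleftrightarrow> N \<in> V"
    using trivial_stable_Hom trivial_stable_Hom_Ident Ident_in_factoring_imp_mem assms(2,4,5)
    by blast
  ultimately show ?thesis by blast
qed

end
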